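(* The sectional curvature $K$ of the Fisher-Rao metric $g^F$ on the space of beta distributions is negative and bounded from below: $K(\alpha,\beta)<0$ for all $\alpha,\beta>0$, and $\inf_{\alpha,\beta>0}K(\alpha,\beta)>-\infty$.
   Context: $\psi(x)=\frac{d}{dx}\ln\Gamma(x)$ is the digamma function and $\psi'$ is its derivative. The Fisher-Rao metric on the parameter space $(0,\infty)\times(0,\infty)$ of the beta distributions $B(\alpha,\beta)$ (density $\frac{\Gamma(\alpha+\beta)}{\Gamma(\alpha)\Gamma(\beta)}x^{\alpha-1}(1-x)^{\beta-1}$ on $[0,1]$) is the Riemannian metric with matrix, in the coordinates $(\alpha,\beta)$, $$g^F(\alpha,\beta)=\begin{pmatrix}\psi'(\alpha)-\psi'(\alpha+\beta) & -\psi'(\alpha+\beta)\\ -\psi'(\alpha+\beta) & \psi'(\beta)-\psi'(\alpha+\beta)\end{pmatrix}.$$ Since this manifold is two-dimensional, its sectional curvature at a point $(\alpha,\beta)$ is a single number, denoted $K(\alpha,\beta)$ (the Gaussian curvature). *)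

theory Defs
  imports "HOL-Analysis.Analysis"
begin

text \<open>
  Riemannian geometry of a coordinate domain in \<open>real ^ 'n\<close>. A metric is given by its matrix
  \<open>g x\<close> in the coordinates at each point \<open>x\<close>; tangent vectors are given by their components in
  the coordinate frame. Points outside the domain play no role as long as the domain is open,
  since only partial derivatives at points of the domain are taken.
\<close>

definition pderiv_at :: "'n::finite \<Rightarrow> (real ^ 'n \<Rightarrow> real) \<Rightarrow> real ^ 'n \<Rightarrow> real" where
  "pderiv_at i f x = deriv (\<lambda>t. f (x + t *\<^sub>R axis i 1)) 0"

text \<open>\<open>christoffel g l i j\<close> is the symbol with upper index \<open>l\<close> and lower indices \<open>i\<close>, \<open>j\<close>.\<close>

definition christoffel ::
  "(real ^ 'n \<Rightarrow> real ^ 'n ^ 'n) \<Rightarrow> 'n::finite \<Rightarrow> 'n \<Rightarrow> 'n \<Rightarrow> real ^ 'n \<Rightarrow> real" where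
  "christoffel g l i j x = (1 / 2) * (\<Sum>m\<in>UNIV. matrix_inv (g x) $ l $ m *
     (pderiv_at i (\<lambda>y. g y $ m $ j) x + pderiv_at j (\<lambda>y. g y $ m $ i) x
      - pderiv_at m (\<lambda>y. g y $ i $ j) x))"

text \<open>
  \<open>riemann g l i j k\<close> is the component along the \<open>l\<close>-th coordinate field of \<open>R(e\<^sub>i, e\<^sub>j) e\<^sub>k\<close>,
  where \<open>R(X, Y) Z = \<nabla>\<^sub>X \<nabla>\<^sub>Y Z - \<nabla>\<^sub>Y \<nabla>\<^sub>X Z - \<nabla>\<^bsub>[X, Y]\<^esub> Z\<close> for the Levi-Civita connection. With this
  sign convention round spheres have positive sectional curvature.
\<close>

definition riemann ::
  "(real ^ 'n \<Rightarrow> real ^ 'n ^ 'n) \<Rightarrow> 'n::finite \<Rightarrow> 'n \<Rightarrow> 'n \<Rightarrow> 'n \<Rightarrow> real ^ 'n \<Rightarrow> real" where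
  "riemann g l i j k x =
     pderiv_at i (christoffel g l j k) x - pderiv_at j (christoffel g l i k) x
     + (\<Sum>m\<in>UNIV. christoffel g l i m x * christoffel g m j k x
                  - christoffel g l j m x * christoffel g m i k x)"

definition curvature_op ::
  "(real ^ 'n \<Rightarrow> real ^ 'n ^ 'n) \<Rightarrow> real ^ 'n \<Rightarrow> real ^ 'n \<Rightarrow> real ^ 'n \<Rightarrow> real ^ 'n \<Rightarrow> real ^ 'n::finite" where
  "curvature_op g x u v w = (\<chi> l. \<Sum>i\<in>UNIV. \<Sum>j\<in>UNIV. \<Sum>k\<in>UNIV.
     riemann g l i j k x * u $ i * v $ j * w $ k)"

definition metric_inner ::
  "(real ^ 'n \<Rightarrow> real ^ 'n ^ 'n) \<Rightarrow> real ^ 'n \<Rightarrow> real ^ 'n \<Rightarrow> real ^ 'n::finite \<Rightarrow> real" where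
  "metric_inner g x u v = u \<bullet> (g x *v v)"

text \<open>Sectional curvature at \<open>x\<close> of the plane spanned by \<open>u\<close>, \<open>v\<close> (linearly independent).\<close>

definition sectional_curvature ::
  "(real ^ 'n \<Rightarrow> real ^ 'n ^ 'n) \<Rightarrow> real ^ 'n \<Rightarrow> real ^ 'n \<Rightarrow> real ^ 'n::finite \<Rightarrow> real" where
  "sectional_curvature g x u v =
     metric_inner g x (curvature_op g x u v v) u /
     (metric_inner g x u u * metric_inner g x v v - (metric_inner g x u v)\<^sup>2)"

lemma deriv_Digamma_eq_Polygamma:
  assumes "(x :: real) > 0"
  shows "deriv Digamma x = Polygamma 1 x"
proof -
  have "x \<notin> \<int>\<^sub>\<le>\<^sub>0"
    using assms by (auto elim!: nonpos_Ints_cases)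
  then show ?thesis
    using has_field_derivative_Polygamma[of x 0 UNIV] by (auto intro: DERIV_imp_deriv)
qed

text \<open>The metric on the parameter space; the point with coordinates \<open>(\<alpha>, \<beta>)\<close> is \<open>vector [\<alpha>, \<beta>]\<close>.\<close>

definition fisher_rao_beta :: "real ^ 2 \<Rightarrow> real ^ 2 ^ 2" where
  "fisher_rao_beta p = vector
     [vector [deriv Digamma (p $ 1) - deriv Digamma (p $ 1 + p $ 2), - deriv Digamma (p $ 1 + p $ 2)],
      vector [- deriv Digamma (p $ 1 + p $ 2), deriv Digamma (p $ 2) - deriv Digamma (p $ 1 + p $ 2)]]"

text \<open>
  The only tangent plane at a point is the whole tangent space, which the two coordinate vectors
  span.
\<close>

definition K_beta :: "real \<Rightarrow> real \<Rightarrow> real" where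
  "K_beta \<alpha> \<beta> = sectional_curvature fisher_rao_beta (vector [\<alpha>, \<beta>]) (axis 1 1) (axis 2 1)"

end

theory Submission
  imports Defs "HOL-Real_Asymp.Real_Asymp"
begin

text \<open>
  Write \<open>s = \<alpha> + \<beta>\<close>. The metric is the Hessian matrix of \<open>ln \<Gamma>(\<alpha>) + ln \<Gamma>(\<beta>) - ln \<Gamma>(s)\<close>. For a
  Hessian metric the fourth derivatives of the potential cancel in the curvature, and in dimension
  two \<open>K = - D / (4 det\<^sup>2)\<close>, where \<open>D\<close> is a cubic determinant in the second and third derivatives
  of the potential (\<open>sectional_curvature_hessian\<close>). For the beta metric \<open>D\<close> and \<open>det\<close> factor
  through the functions \<open>p = 1 / \<psi>'\<close> and \<open>h = \<psi>' / (- \<psi>'') = p / p'\<close>: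

  \<open>4 K = - p'(\<alpha>) p'(\<beta>) p'(s) (h(s) - h(\<alpha>) - h(\<beta>)) / (p(s) - p(\<alpha>) - p(\<beta>))\<^sup>2\<close>.

  So \<open>K\<close> is negative because \<open>h\<close> is strictly superadditive, and everything else is a comparison of
  orders of magnitude. The right yardstick is \<open>m(x) = x / (1 + x)\<close>, which is of order \<open>x\<close> near \<open>0\<close>
  and of order \<open>1\<close> near infinity: \<open>p'\<close> is at most a multiple of \<open>m\<close>, and both defects
  \<open>h(s) - h(\<alpha>) - h(\<beta>)\<close> and \<open>p(s) - p(\<alpha>) - p(\<beta>)\<close> are of order at most, respectively at least,
  \<open>m(\<alpha>) m(\<beta>)\<close> (\<open>hzeta_ratio_defect\<close>, \<open>inverse_hzeta_2_defect\<close>). The powers of \<open>m(\<alpha>)\<close> and \<open>m(\<beta>)\<close> in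
  the quotient cancel, and \<open>m(s) \<le> 1\<close>.

  A function \<open>x q(x)\<close> is superadditive if \<open>q\<close> is increasing, with a defect controlled by the size
  of \<open>q'\<close>. Thus the claims on the defects follow from \<open>0 < (h(x)/x)' \<le> 8 / (1 + x)\<^sup>2\<close> and
  \<open>(p(x)/x)' \<ge> 1 / (4 (1 + x)\<^sup>2)\<close>. In terms of the sums \<open>\<Sum>n. 1 / (x + n)^k\<close> for \<open>k = 2, 3, 4\<close> these
  are delicate inequalities: in both the leading terms cancel as \<open>x\<close> tends to infinity, and in the
  first one the poles cancel as \<open>x\<close> tends to \<open>0\<close>. All these cancellations are respected when the
  term \<open>n = 0\<close> is kept exactly and the rest of the sum is enclosed between its trapezoid and
  midpoint approximations, whose relative error is of second order in \<open>1 / x\<close>. What remains are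
  polynomial inequalities in which all coefficients have the same sign.
\<close>

section \<open>Derivatives of the digamma function as power sums\<close>

text \<open>
  This is the Hurwitz zeta function at the integer \<open>k\<close>; up to sign and factorial it is the
  polygamma function of order \<open>k - 1\<close>.
\<close>

definition hzeta :: "nat \<Rightarrow> real \<Rightarrow> real" where
  "hzeta k x = (\<Sum>n. 1 / (x + real n) ^ k)"

lemma summable_hzeta:
  assumes "x > 0" "k \<ge> 2" shows "summable (\<lambda>n. 1 / (x + real n) ^ k)"
proof -
  have "summable (\<lambda>n. inverse ((x + of_nat n) ^ k))"
    using assms by (intro Polygamma_converges') auto
  thus ?thesis by (simp add: field_simps)
qed

lemma hzeta_eq_Polygamma:
  "Polygamma (Suc n) x = (-1) ^ n * fact (Suc n) * hzeta (n + 2) x"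
  by (simp add: Polygamma_def hzeta_def field_simps)

lemma DERIV_hzeta:
  assumes "x > 0" "k \<ge> 2"
  shows "(hzeta k has_real_derivative - real k * hzeta (Suc k) x) (at x)"
proof -
  obtain n where k: "k = n + 2" using assms(2) by (metis add.commute le_Suc_ex)
  have hzeta: "hzeta (m + 2) = (\<lambda>y. (-1) ^ m / fact (Suc m) * Polygamma (Suc m) y)" for m
    by (rule ext, cases "even m") (simp_all only: hzeta_eq_Polygamma, simp_all del: fact_Suc)
  have "x \<notin> \<int>\<^sub>\<le>\<^sub>0"
    using assms by (auto elim!: nonpos_Ints_cases)
  hence "(Polygamma (Suc n) has_real_derivative Polygamma (Suc (Suc n)) x) (at x)"
    by (rule has_field_derivative_Polygamma)
  hence "((\<lambda>y. (-1) ^ n / fact (Suc n) * Polygamma (Suc n) y) has_real_derivative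
         (-1) ^ n / fact (Suc n) * Polygamma (Suc (Suc n)) x) (at x)"
    by (rule DERIV_cmult)
  moreover have "(-1) ^ n / fact (Suc n) * Polygamma (Suc (Suc n)) x = - real k * hzeta (Suc k) x"
    unfolding hzeta_eq_Polygamma fact_Suc[of "Suc n"] k
    by (cases "even n") (simp_all del: fact_Suc add: algebra_simps)
  ultimately show ?thesis unfolding k hzeta by simp
qed

lemma hzeta_split:
  assumes "x > 0" "k \<ge> 2" shows "hzeta k x = 1 / x ^ k + hzeta k (x + 1)"
  using suminf_split_head[OF summable_hzeta[OF assms]] by (simp add: hzeta_def add_ac)

lemma hzeta_pos: assumes "x > 0" "k \<ge> 2" shows "hzeta k x > 0"
  unfolding hzeta_def using assms by (intro suminf_pos summable_hzeta) auto

section \<open>Rational bounds for the power sums\<close>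

text \<open>
  To compare a power sum with an explicit function \<open>f\<close> vanishing at infinity, it suffices to
  compare the terms with the differences \<open>f(y) - f(y + 1)\<close>.
\<close>

lemma sums_telescope_shift:
  fixes f :: "real \<Rightarrow> real"
  assumes "(f \<longlongrightarrow> 0) at_top"
  shows "(\<lambda>n. f (x + real n) - f (x + real n + 1)) sums f x"
proof -
  have "filterlim (\<lambda>n. x + real n) at_top sequentially"
    by real_asymp
  hence "(\<lambda>n. f (x + real n)) \<longlonglongrightarrow> 0"
    by (rule filterlim_compose[OF assms])
  from telescope_sums'[OF this] show ?thesis by (simp add: add_ac)
qed

lemma telescoping_le_hzeta:
  assumes "x > 0" "k \<ge> 2" and lim: "(f \<longlongrightarrow> 0) at_top"
    and step: "\<And>y. y \<ge> x \<Longrightarrow> f y - f (y + 1) \<le> 1 / y ^ k"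
  shows "f x \<le> hzeta k x"
proof (rule sums_le[OF _ sums_telescope_shift[OF lim]])
  show "(\<lambda>n. 1 / (x + real n) ^ k) sums hzeta k x"
    unfolding hzeta_def by (intro summable_sums summable_hzeta assms)
qed (rule step, simp)

lemma hzeta_le_telescoping:
  assumes "x > 0" "k \<ge> 2" and lim: "(f \<longlongrightarrow> 0) at_top"
    and step: "\<And>y. y \<ge> x \<Longrightarrow> 1 / y ^ k \<le> f y - f (y + 1)"
  shows "hzeta k x \<le> f x"
proof (rule sums_le[OF _ _ sums_telescope_shift[OF lim]])
  show "(\<lambda>n. 1 / (x + real n) ^ k) sums hzeta k x"
    unfolding hzeta_def by (intro summable_sums summable_hzeta assms)
qed (rule step, simp)

text \<open>
  The summand is convex, so each integral over \<open>[y, y + 1]\<close> is at most the mean of the values at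
  the two end points; summing up, \<open>hzeta k x\<close> is at least the integral \<open>x^(1-k) / (k-1)\<close> plus half
  of the first term. With \<open>u = 1 / y\<close> and \<open>v = 1 / (y + 1)\<close>, which satisfy \<open>u - v = u v\<close>, each
  comparison is an inequality between forms in \<open>u\<close> and \<open>v\<close>.
\<close>

lemma trapezoid_le_hzeta:
  fixes x :: real assumes "x > 0"
  shows "(2 * x + 1) / (2 * x ^ 2) \<le> hzeta 2 x"
    and "(x + 1) / (2 * x ^ 3) \<le> hzeta 3 x"
    and "(2 * x + 3) / (6 * x ^ 4) \<le> hzeta 4 x"
proof -
  have rec: "\<exists>u v. u > 0 \<and> v > 0 \<and> u - v = u * v \<and> 1 / y = u \<and> 1 / (y + 1) = v" if "y \<ge> x" for y
    by (rule exI[of _ "1 / y"], rule exI[of _ "1 / (y + 1)"])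
       (use that assms in \<open>simp add: field_simps\<close>)
  show "(2 * x + 1) / (2 * x ^ 2) \<le> hzeta 2 x"
  proof (rule telescoping_le_hzeta)
    fix y assume y: "y \<ge> x"
    then obtain u v where uv: "u > 0" "v > 0" "u - v = u * v" "1 / y = u" "1 / (y + 1) = v"
      using rec by blast
    have 1: "(2 * z + 1) / (2 * z ^ 2) = 1 / z + (1 / z) ^ 2 / 2" if "z > 0" for z :: real
      using that by (simp add: divide_simps power2_eq_square)
    have "(2 * y + 1) / (2 * y ^ 2) - (2 * (y + 1) + 1) / (2 * (y + 1) ^ 2)
        = u * v + (u ^ 2 - v ^ 2) / 2"
      using 1[of y] 1[of "y + 1"] y assms uv by (simp add: diff_divide_distrib)
    also have "\<dots> \<le> u ^ 2"
      using zero_le_power2[of "u - v"] by (simp add: power2_diff field_simps)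
    also have "\<dots> = 1 / y ^ 2" unfolding uv(4)[symmetric] by (simp add: power_divide)
    finally show "(2 * y + 1) / (2 * y ^ 2) - (2 * (y + 1) + 1) / (2 * (y + 1) ^ 2) \<le> 1 / y ^ 2" .
  qed (use assms in \<open>simp_all, real_asymp\<close>)
  show "(x + 1) / (2 * x ^ 3) \<le> hzeta 3 x"
  proof (rule telescoping_le_hzeta)
    fix y assume y: "y \<ge> x"
    then obtain u v where uv: "u > 0" "v > 0" "u - v = u * v" "1 / y = u" "1 / (y + 1) = v"
      using rec by blast
    have 1: "(z + 1) / (2 * z ^ 3) = (1 / z) ^ 2 / 2 + (1 / z) ^ 3 / 2" if "z > 0" for z :: real
      using that by (simp add: divide_simps eval_nat_numeral)
    have "(u - v) * (u ^ 2 - v ^ 2) = (u - v) ^ 2 * (u + v)" by algebra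
    hence c: "(u - v) * (u ^ 2 - v ^ 2) \<ge> 0" using uv by simp
    have "(y + 1) / (2 * y ^ 3) - ((y + 1) + 1) / (2 * (y + 1) ^ 3)
        = (u ^ 2 / 2 + u ^ 3 / 2) - (v ^ 2 / 2 + v ^ 3 / 2)"
      using 1[of y] 1[of "y + 1"] y assms unfolding uv by simp
    also have "\<dots> = (u - v) * (u + v) / 2 + (u ^ 3 - v ^ 3) / 2"
      by (simp add: field_simps power2_eq_square)
    also have "(u - v) * (u + v) = u * v * (u + v)" by (simp only: uv(3))
    also have "u * v * (u + v) / 2 + (u ^ 3 - v ^ 3) / 2 = u ^ 3 - (u - v) * (u ^ 2 - v ^ 2) / 2"
      by (simp add: field_simps eval_nat_numeral)
    also have "\<dots> \<le> u ^ 3" using c by simp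
    also have "\<dots> = 1 / y ^ 3" unfolding uv(4)[symmetric] by (simp add: power_divide)
    finally show "(y + 1) / (2 * y ^ 3) - ((y + 1) + 1) / (2 * (y + 1) ^ 3) \<le> 1 / y ^ 3" .
  qed (use assms in \<open>simp_all, real_asymp\<close>)
  show "(2 * x + 3) / (6 * x ^ 4) \<le> hzeta 4 x"
  proof (rule telescoping_le_hzeta)
    fix y assume y: "y \<ge> x"
    then obtain u v where uv: "u > 0" "v > 0" "u - v = u * v" "1 / y = u" "1 / (y + 1) = v"
      using rec by blast
    have 1: "(2 * z + 3) / (6 * z ^ 4) = (1 / z) ^ 3 / 3 + (1 / z) ^ 4 / 2" if "z > 0" for z :: real
      using that by (simp add: divide_simps eval_nat_numeral)
    have "(u - v) * (u ^ 3 - v ^ 3) = (u - v) ^ 2 * (u ^ 2 + u * v + v ^ 2)" by algebra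
    hence c: "(u - v) * (u ^ 3 - v ^ 3) \<ge> 0" using uv by simp
    have "(2 * y + 3) / (6 * y ^ 4) - (2 * (y + 1) + 3) / (6 * (y + 1) ^ 4)
        = (u ^ 3 / 3 + u ^ 4 / 2) - (v ^ 3 / 3 + v ^ 4 / 2)"
      using 1[of y] 1[of "y + 1"] y assms unfolding uv by simp
    also have "\<dots> = (u - v) * (u ^ 2 + u * v + v ^ 2) / 3 + (u ^ 4 - v ^ 4) / 2"
      by (simp add: field_simps eval_nat_numeral)
    also have "(u - v) * (u ^ 2 + u * v + v ^ 2) = u * v * (u ^ 2 + u * v + v ^ 2)"
      by (simp only: uv(3))
    also have "u * v * (u ^ 2 + u * v + v ^ 2) / 3 + (u ^ 4 - v ^ 4) / 2
        = u ^ 4 - ((u - v) * (u ^ 3 - v ^ 3) / 3 + (u ^ 2 - v ^ 2) ^ 2 / 6)"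
      by (simp add: field_simps eval_nat_numeral)
    also have "\<dots> \<le> u ^ 4"
      using c zero_le_power2[of "u ^ 2 - v ^ 2"] by linarith
    also have "\<dots> = 1 / y ^ 4" unfolding uv(4)[symmetric] by (simp add: power_divide)
    finally show "(2 * y + 3) / (6 * y ^ 4) - (2 * (y + 1) + 3) / (6 * (y + 1) ^ 4) \<le> 1 / y ^ 4" .
  qed (use assms in \<open>simp_all, real_asymp\<close>)
qed

text \<open>
  Again by convexity, each term \<open>1 / y^k\<close> is at most the integral over \<open>[y - 1/2, y + 1/2]\<close>; the
  bounds are the integrals from \<open>x - 1/2\<close> to infinity.
\<close>

lemma hzeta_le_midpoint:
  fixes x :: real assumes "x > 1 / 2"
  shows "hzeta 2 x \<le> 2 / (2 * x - 1)"
    and "hzeta 3 x \<le> 2 / (2 * x - 1) ^ 2"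
    and "hzeta 4 x \<le> 8 / (3 * (2 * x - 1) ^ 3)"
proof -
  have t: "\<exists>t>1. y = t / 2 \<and> 0 < t\<^sup>2 - 1" if "y \<ge> x" for y
    using one_less_power[of "2 * y" 2] that assms by (intro exI[of _ "2 * y"]) auto
  show "hzeta 2 x \<le> 2 / (2 * x - 1)"
  proof (rule hzeta_le_telescoping)
    fix y assume y: "y \<ge> x"
    then obtain t where t: "t > 1" "y = t / 2" "0 < t\<^sup>2 - 1" using t by blast
    have "1 / y ^ 2 = 4 / t\<^sup>2" by (simp add: t power_divide)
    also have "\<dots> \<le> 4 / (t\<^sup>2 - 1)" using t(1,3) by (intro frac_le) auto
    also have "t\<^sup>2 - 1 = (t - 1) * (t + 1)" by (simp add: algebra_simps power2_eq_square)
    also have "4 / ((t - 1) * (t + 1)) = 2 / (t - 1) - 2 / (t + 1)"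
      using t by (simp add: divide_simps)
    finally show "1 / y ^ 2 \<le> 2 / (2 * y - 1) - 2 / (2 * (y + 1) - 1)" by (simp add: t add.commute)
  qed (use assms in \<open>simp_all, real_asymp\<close>)
  show "hzeta 3 x \<le> 2 / (2 * x - 1) ^ 2"
  proof (rule hzeta_le_telescoping)
    fix y assume y: "y \<ge> x"
    then obtain t where t: "t > 1" "y = t / 2" "0 < t\<^sup>2 - 1" using t by blast
    hence ne: "t\<^sup>2 \<noteq> 1" by linarith
    have "1 / y ^ 3 = 8 * t / (t\<^sup>2)\<^sup>2"
      using t(1,3) by (simp add: t(2) power_divide divide_simps eval_nat_numeral)
    also have "\<dots> \<le> 8 * t / (t\<^sup>2 - 1)\<^sup>2"
      using t(1,3) ne by (intro frac_le power_mono) auto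
    also have "t\<^sup>2 - 1 = (t - 1) * (t + 1)" by (simp add: algebra_simps power2_eq_square)
    also have "8 * t / ((t - 1) * (t + 1))\<^sup>2 = 2 / (t - 1) ^ 2 - 2 / (t + 1) ^ 2"
      using t by (simp add: divide_simps) (simp add: algebra_simps power2_eq_square)
    finally show "1 / y ^ 3 \<le> 2 / (2 * y - 1) ^ 2 - 2 / (2 * (y + 1) - 1) ^ 2"
      by (simp add: t add.commute)
  qed (use assms in \<open>simp_all, real_asymp\<close>)
  show "hzeta 4 x \<le> 8 / (3 * (2 * x - 1) ^ 3)"
  proof (rule hzeta_le_telescoping)
    fix y assume y: "y \<ge> x"
    then obtain t where t: "t > 1" "y = t / 2" "0 < t\<^sup>2 - 1" using t by blast
    hence ne: "t\<^sup>2 \<noteq> 1" by linarith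
    have "1 / y ^ 4 = 16 * t\<^sup>2 / (t\<^sup>2) ^ 3"
      using t(1,3) by (simp add: t(2) power_divide divide_simps eval_nat_numeral)
    also have "\<dots> \<le> (16 * t\<^sup>2 + 16 / 3) / (t\<^sup>2 - 1) ^ 3"
      using t(1,3) ne by (intro frac_le power_mono) auto
    also have "t\<^sup>2 - 1 = (t - 1) * (t + 1)" by (simp add: algebra_simps power2_eq_square)
    also have "(16 * t\<^sup>2 + 16 / 3) / ((t - 1) * (t + 1)) ^ 3
        = 8 / (3 * (t - 1) ^ 3) - 8 / (3 * (t + 1) ^ 3)"
      using t by (simp add: divide_simps) (simp add: algebra_simps eval_nat_numeral)
    finally show "1 / y ^ 4 \<le> 8 / (3 * (2 * y - 1) ^ 3) - 8 / (3 * (2 * (y + 1) - 1) ^ 3)"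
      by (simp add: t add.commute)
  qed (use assms in \<open>simp_all, real_asymp\<close>)
qed

text \<open>
  Up to a factor \<open>2\<close>, the simple expression \<open>(1 + x) / x^k\<close> captures both regimes: \<open>x^-k\<close> near \<open>0\<close>
  and \<open>x^(1-k)\<close> near infinity.
\<close>

lemma hzeta_2_bounds:
  assumes "x > 0" shows "(1 + x) / (2 * x ^ 2) \<le> hzeta 2 x" "hzeta 2 x \<le> (1 + x) / x ^ 2"
proof -
  have "(1 + x) / (2 * x ^ 2) \<le> (2 * x + 1) / (2 * x ^ 2)" using assms by (intro divide_right_mono) auto
  also have "\<dots> \<le> hzeta 2 x" by (rule trapezoid_le_hzeta[OF assms])
  finally show "(1 + x) / (2 * x ^ 2) \<le> hzeta 2 x" .
  have "hzeta 2 x = 1 / x ^ 2 + hzeta 2 (x + 1)" by (rule hzeta_split) (use assms in auto)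
  also have "hzeta 2 (x + 1) \<le> 2 / (2 * (x + 1) - 1)" by (rule hzeta_le_midpoint) (use assms in auto)
  also have "\<dots> \<le> 1 / x" using assms by (simp add: field_simps)
  also have "1 / x ^ 2 + 1 / x = (1 + x) / x ^ 2" using assms by (simp add: field_simps power2_eq_square)
  finally show "hzeta 2 x \<le> (1 + x) / x ^ 2" by simp
qed

lemma hzeta_3_bounds:
  assumes "x > 0" shows "(1 + x) / (2 * x ^ 3) \<le> hzeta 3 x" "hzeta 3 x \<le> (1 + x) / x ^ 3"
proof -
  show "(1 + x) / (2 * x ^ 3) \<le> hzeta 3 x" using trapezoid_le_hzeta(2)[OF assms] by (simp add: add_ac)
  have "hzeta 3 x = 1 / x ^ 3 + hzeta 3 (x + 1)" by (rule hzeta_split) (use assms in auto)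
  also have "hzeta 3 (x + 1) \<le> 2 / (2 * (x + 1) - 1) ^ 2" by (rule hzeta_le_midpoint) (use assms in auto)
  also have "\<dots> \<le> 1 / x ^ 2"
    using assms by (simp add: divide_simps) (simp add: algebra_simps power2_eq_square)
  also have "1 / x ^ 3 + 1 / x ^ 2 = (1 + x) / x ^ 3" using assms by (simp add: field_simps eval_nat_numeral)
  finally show "hzeta 3 x \<le> (1 + x) / x ^ 3" by simp
qed

text \<open>
  The difference \<open>2 x hzeta 3 x - hzeta 2 x\<close> is the numerator of the derivative of
  \<open>1 / (x hzeta 2 x)\<close>. At infinity both terms are asymptotic to \<open>1 / x\<close>, so bounds of second order
  are needed; the difference is asymptotic to \<open>1 / (2 x\<^sup>2)\<close> there and to \<open>1 / x\<^sup>2\<close> at \<open>0\<close>.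
\<close>

lemma hzeta_3_minus_hzeta_2:
  assumes "x > 0" shows "2 * x * hzeta 3 x - hzeta 2 x \<ge> 1 / (4 * x ^ 2)"
proof -
  define y w where "y = x + 1" and "w = 2 * x + 1"
  have yw: "y > 0" "w > 0" "2 * (x + 1) - 1 = w" using assms by (auto simp: y_def w_def)
  have 3: "hzeta 3 x \<ge> 1 / x ^ 3 + (y + 1) / (2 * y ^ 3)"
    using hzeta_split[of x 3] trapezoid_le_hzeta(2)[of y] assms yw by (simp add: y_def)
  have 2: "hzeta 2 x \<le> 1 / x ^ 2 + 2 / w"
    using hzeta_split[of x 2] hzeta_le_midpoint(1)[of "x + 1"] assms yw by simp
  \<comment> \<open>The difference of the two sides, with the bounds inserted, over a common denominator.\<close>
  have "4 * x ^ 2 * (x * (y + 1) * w - 2 * y ^ 3) + 3 * y ^ 3 * w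
      = 3 + 15 * x + 19 * x ^ 2 + 5 * x ^ 3 + 2 * x ^ 4"
    by (simp add: y_def w_def algebra_simps eval_nat_numeral)
  hence "0 \<le> (4 * x ^ 2 * (x * (y + 1) * w - 2 * y ^ 3) + 3 * y ^ 3 * w) / (4 * x ^ 2 * y ^ 3 * w)"
    using assms yw by simp
  also have "\<dots> = 2 * x * (1 / x ^ 3 + (y + 1) / (2 * y ^ 3)) - (1 / x ^ 2 + 2 / w) - 1 / (4 * x ^ 2)"
    using assms yw by (simp add: divide_simps) (simp add: algebra_simps eval_nat_numeral)
  finally have "1 / (4 * x ^ 2) \<le> 2 * x * (1 / x ^ 3 + (y + 1) / (2 * y ^ 3)) - (1 / x ^ 2 + 2 / w)"
    by simp
  also have "\<dots> \<le> 2 * x * hzeta 3 x - hzeta 2 x"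
    by (intro diff_mono mult_left_mono 2 3) (use assms in auto)
  finally show ?thesis .
qed

text \<open>
  The derivative of \<open>hzeta 2 x / (2 x hzeta 3 x)\<close> has the numerator \<open>S\<^sub>2 (3 x S\<^sub>4 - S\<^sub>3) - 2 x S\<^sub>3\<^sup>2\<close>
  with \<open>S\<^sub>k = hzeta k x = 1 / x^k + hzeta k (x + 1)\<close>. Its pole of order five at \<open>0\<close> cancels;
  \<open>slope_num\<close> is what is left, times \<open>x^3\<close>, as a function of the tails \<open>A\<close>, \<open>B\<close>, \<open>C\<close> of the sums
  for \<open>k = 2, 3, 4\<close>.
\<close>

definition slope_num :: "real \<Rightarrow> real \<Rightarrow> real \<Rightarrow> real \<Rightarrow> real" where
  "slope_num x A B C = 2 * A - 5 * B * x + 3 * C * x ^ 2 + 3 * x ^ 4 * A * C - x ^ 3 * A * B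
     - 2 * x ^ 4 * B ^ 2"

lemma slope_eq_slope_num:
  assumes "x > 0"
  shows "hzeta 2 x * (3 * x * hzeta 4 x - hzeta 3 x) - 2 * x * hzeta 3 x ^ 2 =
    slope_num x (hzeta 2 (x + 1)) (hzeta 3 (x + 1)) (hzeta 4 (x + 1)) / x ^ 3"
proof -
  have "(1 / x ^ 2 + a) * (3 * x * (1 / x ^ 4 + c) - (1 / x ^ 3 + b)) - 2 * x * (1 / x ^ 3 + b) ^ 2 =
    slope_num x a b c / x ^ 3" for a b c
    using assms by (simp add: slope_num_def divide_simps) (simp add: algebra_simps eval_nat_numeral)
  thus ?thesis
    using assms by (simp add: hzeta_split[of x 2] hzeta_split[of x 3] hzeta_split[of x 4])
qed

text \<open>
  In the relevant range \<open>slope_num\<close> increases with \<open>A\<close> and \<open>C\<close> and decreases with \<open>B\<close>. Hence it is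
  bounded by its values at the trapezoid and midpoint approximations. These are rational functions
  of \<open>x\<close>, and with \<open>y = x + 1\<close> and \<open>w = 2 x + 1\<close> as the factors of the denominators, the
  numerators of the lower approximation and of the gap between \<open>4 / y\<close> and the upper approximation
  turn out to have nonnegative coefficients only. The constant \<open>4\<close> is the value of the upper
  approximation at \<open>x = 0\<close>.
\<close>

lemma slope_num_bounds:
  fixes x :: real
  assumes "x > 0"
  defines "A \<equiv> hzeta 2 (x + 1)" and "B \<equiv> hzeta 3 (x + 1)" and "C \<equiv> hzeta 4 (x + 1)"
  shows "slope_num x A B C > 0" "slope_num x A B C \<le> 4 / (1 + x)"
proof -
  define y w where "y = x + 1" and "w = 2 * x + 1"
  have yw: "y > 0" "w > 0" "2 * (x + 1) - 1 = w" using assms by (auto simp: y_def w_def)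
  define A1 B1 C1 where "A1 = (2 * y + 1) / (2 * y ^ 2)" and "B1 = (y + 1) / (2 * y ^ 3)"
     and "C1 = (2 * y + 3) / (6 * y ^ 4)"
  define A2 B2 C2 where "A2 = 2 / w" and "B2 = 2 / w ^ 2" and "C2 = 8 / (3 * w ^ 3)"
  have bnd: "A1 \<le> A" "B1 \<le> B" "C1 \<le> C" "A \<le> A2" "B \<le> B2" "C \<le> C2"
    using trapezoid_le_hzeta[of y] hzeta_le_midpoint[of "x + 1"] assms yw
    unfolding A1_def B1_def C1_def A2_def B2_def C2_def A_def B_def C_def y_def by simp_all
  have pos: "A1 > 0" "B1 > 0" "C1 > 0" using yw by (simp_all add: A1_def B1_def C1_def)
  \<comment> \<open>The coefficient of \<open>A\<close>.\<close>
  have coeff: "2 + 3 * x ^ 4 * c - x ^ 3 * b \<ge> 0" if "C1 \<le> c" "b \<le> B2" for b c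
  proof -
    have "4 * y ^ 4 + x ^ 4 * (2 * y + 3) - x * y ^ 4 =
        4 + 15 * x + 20 * x ^ 2 + 10 * x ^ 3 + 5 * x ^ 4 + x ^ 5"
      by (simp add: y_def algebra_simps eval_nat_numeral)
    hence "x * y ^ 4 \<le> 4 * y ^ 4 + x ^ 4 * (2 * y + 3)" using assms by (smt (verit) zero_less_power)
    hence "x / 2 \<le> 2 + 3 * x ^ 4 * C1" using yw by (simp add: C1_def field_simps)
    moreover have "x ^ 3 * B2 \<le> x / 2"
      using yw assms by (simp add: B2_def w_def divide_simps) (simp add: algebra_simps eval_nat_numeral)
    moreover have "x ^ 4 * C1 \<le> x ^ 4 * c" "x ^ 3 * b \<le> x ^ 3 * B2"
      using that assms by (simp_all add: mult_left_mono)
    ultimately show ?thesis by linarith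
  qed
  have mono_A: "slope_num x a b c \<le> slope_num x a' b c" if "a \<le> a'" "C1 \<le> c" "b \<le> B2" for a a' b c
  proof -
    have "slope_num x a' b c - slope_num x a b c = (a' - a) * (2 + 3 * x ^ 4 * c - x ^ 3 * b)"
      by (simp add: slope_num_def algebra_simps)
    also have "\<dots> \<ge> 0" using that by (intro mult_nonneg_nonneg coeff) auto
    finally show ?thesis by simp
  qed
  have mono_B: "slope_num x a b' c \<le> slope_num x a b c" if "0 \<le> b" "b \<le> b'" "0 \<le> a" for a b b' c
  proof -
    have "slope_num x a b c - slope_num x a b' c = (b' - b) * (5 * x + x ^ 3 * a + 2 * x ^ 4 * (b + b'))"
      by (simp add: slope_num_def algebra_simps power2_eq_square)
    also have "\<dots> \<ge> 0" using that assms by (intro mult_nonneg_nonneg add_nonneg_nonneg) auto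
    finally show ?thesis by simp
  qed
  have mono_C: "slope_num x a b c \<le> slope_num x a b c'" if "c \<le> c'" "0 \<le> a" for a b c c'
  proof -
    have "slope_num x a b c' - slope_num x a b c = (c' - c) * (3 * x ^ 2 + 3 * x ^ 4 * a)"
      by (simp add: slope_num_def algebra_simps power2_eq_square)
    also have "\<dots> \<ge> 0" using that assms by (intro mult_nonneg_nonneg add_nonneg_nonneg) auto
    finally show ?thesis by simp
  qed
  define N1 where "N1 = 12 * y ^ 4 * w ^ 4 * (2 * y + 1) - 120 * x * w ^ 2 * y ^ 6
     + 6 * x ^ 2 * y ^ 2 * w ^ 4 * (2 * y + 3) + 3 * x ^ 4 * (2 * y + 1) * (2 * y + 3) * w ^ 4
     - 12 * x ^ 3 * (2 * y + 1) * y ^ 4 * w ^ 2 - 96 * x ^ 4 * y ^ 6"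
  have "N1 = 36 + 336 * x + 1350 * x ^ 2 + 3084 * x ^ 3 + 4383 * x ^ 4 + 3900 * x ^ 5
      + 2052 * x ^ 6 + 612 * x ^ 7 + 168 * x ^ 8 + 48 * x ^ 9"
    by (simp add: N1_def y_def w_def algebra_simps eval_nat_numeral)
  also have "\<dots> > 0" using assms by (intro add_pos_pos) auto
  finally have "0 < N1 / (12 * y ^ 6 * w ^ 4)" using yw by simp
  also have "\<dots> = slope_num x A1 B2 C1"
    using yw by (simp add: N1_def slope_num_def A1_def B2_def C1_def divide_simps)
       (simp add: algebra_simps eval_nat_numeral)
  also have "\<dots> \<le> slope_num x A B2 C1" by (rule mono_A) (use bnd in auto)
  also have "\<dots> \<le> slope_num x A B C1" by (rule mono_B) (use bnd pos in auto)
  also have "\<dots> \<le> slope_num x A B C" by (rule mono_C) (use bnd pos in auto)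
  finally show "slope_num x A B C > 0" .
  have "slope_num x A B C \<le> slope_num x A2 B C" by (rule mono_A) (use bnd in auto)
  also have "\<dots> \<le> slope_num x A2 B1 C" by (rule mono_B) (use bnd pos in auto)
  also have "\<dots> \<le> slope_num x A2 B1 C2" by (rule mono_C) (use bnd pos in auto)
  also have "\<dots> \<le> 4 / y"
  proof -
    define N2 where "N2 = 8 * w ^ 4 * y ^ 5 - (8 * w ^ 3 * y ^ 6 - 5 * x * (y + 1) * w ^ 4 * y ^ 3
      + 16 * x ^ 2 * w * y ^ 6 + 32 * x ^ 4 * y ^ 6 - 2 * x ^ 3 * (y + 1) * w ^ 3 * y ^ 3
      - x ^ 4 * (y + 1) ^ 2 * w ^ 4)"
    have "N2 = 18 * x + 187 * x ^ 2 + 857 * x ^ 3 + 2227 * x ^ 4 + 3559 * x ^ 5 + 3575 * x ^ 6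
        + 2214 * x ^ 7 + 780 * x ^ 8 + 120 * x ^ 9"
      by (simp add: N2_def y_def w_def algebra_simps eval_nat_numeral)
    hence "0 \<le> N2 / (2 * y ^ 6 * w ^ 4)" using assms yw by simp
    moreover have "slope_num x A2 B1 C2 = 4 / y - N2 / (2 * y ^ 6 * w ^ 4)"
      using yw by (simp add: N2_def slope_num_def A2_def B1_def C2_def divide_simps)
         (simp add: algebra_simps eval_nat_numeral)
    ultimately show ?thesis by simp
  qed
  finally show "slope_num x A B C \<le> 4 / (1 + x)" by (simp add: y_def add_ac)
qed

section \<open>Superadditivity of two functions built from the digamma function\<close>

text \<open>
  Slopes of size \<open>1 / (1 + x)\<^sup>2\<close> integrate to \<open>- 1 / (1 + x)\<close>, and \<open>x\<close> times this is \<open>- m(x)\<close>. The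
  defects of superadditivity below are therefore measured by \<open>m(a) + m(b) - m(a + b)\<close>; replacing
  this by the product \<open>m(a) m(b)\<close> is what makes the factors cancel in the curvature.
\<close>

lemma weighted_defect:
  fixes a b :: real assumes "a > 0" "b > 0"
  defines "m \<equiv> \<lambda>x::real. x / (1 + x)"
  shows "m a * m b \<le> m a + m b - m (a + b)" "m a + m b - m (a + b) \<le> 2 * (m a * m b)"
proof -
  have "m a + m b - m (a + b) - m a * m b = a * b / ((1 + a) * (1 + b) * (1 + a + b))"
    using assms by (simp add: divide_simps) (simp add: algebra_simps)
  thus "m a * m b \<le> m a + m b - m (a + b)"
    using assms by (smt (verit) divide_nonneg_nonneg mult_nonneg_nonneg)
  have "2 * (m a * m b) - (m a + m b - m (a + b)) = a * b * (a + b) / ((1 + a) * (1 + b) * (1 + a + b))"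
    using assms by (simp add: divide_simps) (simp add: algebra_simps)
  thus "m a + m b - m (a + b) \<le> 2 * (m a * m b)"
    using assms by (smt (verit) divide_nonneg_nonneg mult_nonneg_nonneg)
qed

text \<open>
  The function \<open>Q(x) = q(x) + c / (1 + x)\<close> is increasing, and therefore
  \<open>a (Q(a + b) - Q(a)) + b (Q(a + b) - Q(b))\<close> is nonnegative. The constant \<open>c\<close> may be negative:
  applied to \<open>- q\<close> this gives an upper bound on the defect of \<open>x q(x)\<close>.
\<close>

lemma superadditive_of_DERIV:
  fixes q q' :: "real \<Rightarrow> real" and a b c :: real
  assumes deriv: "\<And>x. x > 0 \<Longrightarrow> (q has_real_derivative q' x) (at x)"
    and lb: "\<And>x. x > 0 \<Longrightarrow> c / (1 + x)\<^sup>2 \<le> q' x"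
    and "a > 0" "b > 0"
  shows "c * (a / (1 + a) + b / (1 + b) - (a + b) / (1 + (a + b)))
           \<le> (a + b) * q (a + b) - a * q a - b * q b"
proof -
  define Q where "Q = (\<lambda>x. q x + c / (1 + x))"
  have Q: "Q x \<le> Q y" if "0 < x" "x \<le> y" for x y
  proof (rule DERIV_nonneg_imp_nondecreasing[OF \<open>x \<le> y\<close>])
    fix z assume "x \<le> z" "z \<le> y"
    hence z: "z > 0" using that by simp
    have "(Q has_real_derivative q' z - c / (1 + z)\<^sup>2) (at z)"
      unfolding Q_def using z
      by (auto intro!: derivative_eq_intros deriv simp: power2_eq_square)
    thus "\<exists>D. (Q has_real_derivative D) (at z) \<and> 0 \<le> D" using lb[OF z] by auto
  qed
  have "0 \<le> a * (Q (a + b) - Q a) + b * (Q (a + b) - Q b)"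
    using assms Q[of a "a + b"] Q[of b "a + b"] by (intro add_nonneg_nonneg mult_nonneg_nonneg) auto
  also have "\<dots> = (a + b) * q (a + b) - a * q a - b * q b
      - c * (a / (1 + a) + b / (1 + b) - (a + b) / (1 + (a + b)))"
    by (simp add: Q_def algebra_simps add_divide_distrib)
  finally show ?thesis by simp
qed

lemma strict_superadditive_of_DERIV:
  fixes q q' :: "real \<Rightarrow> real" and a b :: real
  assumes deriv: "\<And>x. x > 0 \<Longrightarrow> (q has_real_derivative q' x) (at x)"
    and pos: "\<And>x. x > 0 \<Longrightarrow> 0 < q' x"
    and "a > 0" "b > 0"
  shows "a * q a + b * q b < (a + b) * q (a + b)"
proof -
  have Q: "q x < q y" if "0 < x" "x < y" for x y
    using deriv pos that by (intro DERIV_pos_imp_increasing[OF \<open>x < y\<close>]) (meson less_le_trans)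
  have "a * q a + b * q b < a * q (a + b) + b * q (a + b)"
    using assms Q[of a "a + b"] Q[of b "a + b"] by (intro add_strict_mono mult_strict_left_mono) auto
  thus ?thesis by (simp add: algebra_simps)
qed

text \<open>
  The superadditivity of \<open>p = 1 / \<psi>'\<close>, from \<open>(p(x)/x)' \<ge> 1 / (4 (1 + x)\<^sup>2)\<close>. It makes the beta
  metric nondegenerate, and its quantitative form controls the denominator of the curvature.
\<close>

lemma inverse_hzeta_2_defect:
  assumes "a > 0" "b > 0"
  shows "a / (1 + a) * (b / (1 + b)) / 4 \<le> 1 / hzeta 2 (a + b) - 1 / hzeta 2 a - 1 / hzeta 2 b"
proof -
  define q where "q = (\<lambda>x. 1 / (x * hzeta 2 x))"
  define q' where "q' = (\<lambda>x. (2 * x * hzeta 3 x - hzeta 2 x) / (x * hzeta 2 x)\<^sup>2)"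
  have D: "(q has_real_derivative q' x) (at x)" if "x > 0" for x
    unfolding q_def q'_def using that hzeta_pos[OF that, of 2]
    by (auto intro!: derivative_eq_intros DERIV_hzeta simp: power2_eq_square)
  have lb: "(1 / 4) / (1 + x)\<^sup>2 \<le> q' x" if "x > 0" for x
  proof -
    have "x * hzeta 2 x \<le> x * ((1 + x) / x ^ 2)"
      using hzeta_2_bounds[OF that] that by (intro mult_left_mono) auto
    hence "(x * hzeta 2 x)\<^sup>2 \<le> (x * ((1 + x) / x ^ 2))\<^sup>2"
      using that hzeta_pos[OF that, of 2] by (intro power_mono) auto
    moreover have "0 \<le> 2 * x * hzeta 3 x - hzeta 2 x"
      by (rule order.trans[OF _ hzeta_3_minus_hzeta_2[OF that]]) simp
    ultimately have "(1 / (4 * x ^ 2)) / (x * ((1 + x) / x ^ 2))\<^sup>2 \<le> q' x"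
      unfolding q'_def using hzeta_3_minus_hzeta_2[OF that] that hzeta_pos[OF that, of 2]
      by (intro frac_le) auto
    also have "(1 / (4 * x ^ 2)) / (x * ((1 + x) / x ^ 2))\<^sup>2 = (1 / 4) / (1 + x)\<^sup>2"
      using that by (simp add: divide_simps)
    finally show ?thesis .
  qed
  have "a / (1 + a) * (b / (1 + b)) / 4 \<le> 1 / 4 * (a / (1 + a) + b / (1 + b) - (a + b) / (1 + (a + b)))"
    using weighted_defect(1)[OF assms] by simp
  also have "\<dots> \<le> (a + b) * q (a + b) - a * q a - b * q b"
    by (rule superadditive_of_DERIV[OF D lb assms])
  also have "\<dots> = 1 / hzeta 2 (a + b) - 1 / hzeta 2 a - 1 / hzeta 2 b"
    using assms by (simp add: q_def)
  finally show ?thesis .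
qed

text \<open>
  For \<open>h = \<psi>' / (- \<psi>'')\<close> the two bounds \<open>0 < (h(x)/x)' \<le> 8 / (1 + x)\<^sup>2\<close> give the two claims. The
  first claim determines the sign of the curvature and the second one its size.
\<close>

lemma hzeta_ratio_defect:
  assumes "a > 0" "b > 0"
  defines "h \<equiv> \<lambda>x. hzeta 2 x / (2 * hzeta 3 x)"
  shows "h a + h b < h (a + b)" "h (a + b) - h a - h b \<le> 16 * (a / (1 + a) * (b / (1 + b)))"
proof -
  define q where "q = (\<lambda>x. hzeta 2 x / (2 * x * hzeta 3 x))"
  define F where "F = (\<lambda>x. hzeta 2 x * (3 * x * hzeta 4 x - hzeta 3 x) - 2 * x * hzeta 3 x ^ 2)"
  define q' where "q' = (\<lambda>x. F x / (2 * (x * hzeta 3 x)\<^sup>2))"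
  have D: "(q has_real_derivative q' x) (at x)" if "x > 0" for x
  proof -
    have "hzeta 3 x > 0" using hzeta_pos[OF that, of 3] by simp
    have "(q has_real_derivative ((- 2 * hzeta 3 x) * (2 * x * hzeta 3 x)
        - hzeta 2 x * (2 * hzeta 3 x + (- 3 * hzeta 4 x) * (2 * x)))
        / ((2 * x * hzeta 3 x) * (2 * x * hzeta 3 x))) (at x)"
      unfolding q_def using that \<open>hzeta 3 x > 0\<close> DERIV_hzeta[OF that, of 2] DERIV_hzeta[OF that, of 3]
      by (intro DERIV_divide DERIV_mult DERIV_cmult_Id) auto
    also have "((- 2 * hzeta 3 x) * (2 * x * hzeta 3 x)
        - hzeta 2 x * (2 * hzeta 3 x + (- 3 * hzeta 4 x) * (2 * x)))
        / ((2 * x * hzeta 3 x) * (2 * x * hzeta 3 x)) = q' x"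
      unfolding q'_def F_def using that \<open>hzeta 3 x > 0\<close>
      by (simp add: divide_simps) (simp add: algebra_simps power2_eq_square)
    finally show ?thesis .
  qed
  have F: "0 < F x" "F x \<le> 4 / (1 + x) / x ^ 3" if "x > 0" for x
    unfolding F_def slope_eq_slope_num[OF that]
    using slope_num_bounds(1)[OF that] that
      divide_right_mono[OF slope_num_bounds(2)[OF that], of "x ^ 3"]
    by (auto intro: divide_pos_pos)
  have pos: "q' x > 0" if "x > 0" for x
    unfolding q'_def using F(1)[OF that] that hzeta_pos[OF that, of 3] by simp
  have ub: "q' x \<le> 8 / (1 + x)\<^sup>2" if "x > 0" for x
  proof -
    have "x * ((1 + x) / (2 * x ^ 3)) \<le> x * hzeta 3 x"
      using hzeta_3_bounds[OF that] that by (intro mult_left_mono) auto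
    hence "(x * ((1 + x) / (2 * x ^ 3)))\<^sup>2 \<le> (x * hzeta 3 x)\<^sup>2"
      using that by (intro power_mono) auto
    hence "q' x \<le> (4 / (1 + x) / x ^ 3) / (2 * (x * ((1 + x) / (2 * x ^ 3)))\<^sup>2)"
      unfolding q'_def using F[OF that] that by (intro frac_le) auto
    also have "\<dots> = 8 / (1 + x)\<^sup>2 * (x / (1 + x))"
      using that by (simp add: divide_simps eval_nat_numeral)
    also have "\<dots> \<le> 8 / (1 + x)\<^sup>2 * 1"
      using that by (intro mult_left_mono) auto
    finally show ?thesis by simp
  qed
  have xq: "x * q x = h x" if "x > 0" for x using that by (simp add: q_def h_def)
  show "h a + h b < h (a + b)"
    using strict_superadditive_of_DERIV[of q q', OF D pos assms(1,2)] assms(1,2) by (simp add: xq)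
  have "(- 8) * (a / (1 + a) + b / (1 + b) - (a + b) / (1 + (a + b)))
     \<le> (a + b) * - q (a + b) - a * - q a - b * - q b"
    by (rule superadditive_of_DERIV[where q' = "\<lambda>x. - q' x"]) (use D ub assms in \<open>auto intro: DERIV_minus\<close>)
  hence "h (a + b) - h a - h b \<le> 8 * (a / (1 + a) + b / (1 + b) - (a + b) / (1 + (a + b)))"
    using xq[of a] xq[of b] xq[of "a + b"] assms(1,2) by simp
  also have "\<dots> \<le> 8 * (2 * (a / (1 + a) * (b / (1 + b))))"
    by (intro mult_left_mono weighted_defect assms) auto
  finally show "h (a + b) - h a - h b \<le> 16 * (a / (1 + a) * (b / (1 + b)))" by simp
qed

section \<open>Curvature of Hessian metrics in dimension two\<close>

lemma matrix_inv_eqI: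
  fixes A B :: "'a::semiring_1 ^ 'n ^ 'n"
  assumes "A ** B = mat 1" "B ** A = mat 1"
  shows "matrix_inv A = B"
proof -
  have "A ** matrix_inv A = mat 1 \<and> matrix_inv A ** A = mat 1"
    unfolding matrix_inv_def by (rule someI[of _ B]) (use assms in auto)
  hence "matrix_inv A = B ** A ** matrix_inv A" using assms by simp
  also have "\<dots> = B" using \<open>A ** matrix_inv A = mat 1 \<and> _\<close>
    by (simp flip: matrix_mul_assoc)
  finally show ?thesis .
qed

lemma matrix_inv_2:
  fixes A :: "'a::field ^ 2 ^ 2"
  assumes "det A \<noteq> 0"
  shows "matrix_inv A = vector [vector [A $ 2 $ 2 / det A, - A $ 1 $ 2 / det A],
                               vector [- A $ 2 $ 1 / det A, A $ 1 $ 1 / det A]]"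
  by (rule matrix_inv_eqI;
      use assms in \<open>simp add: vec_eq_iff forall_2 matrix_matrix_mult_def sum_2 mat_def det_2
        divide_simps\<close>;
      simp add: algebra_simps)

lemma eventually_shift_in_open:
  fixes x :: "real ^ 'n"
  assumes "open U" "x \<in> U"
  shows "eventually (\<lambda>t. x + t *\<^sub>R axis i 1 \<in> U) (nhds 0)"
proof -
  have "((\<lambda>t::real. x + t *\<^sub>R axis i 1) \<longlongrightarrow> x + 0 *\<^sub>R axis i 1) (nhds 0)"
    by (intro tendsto_intros filterlim_ident)
  thus ?thesis using assms by (auto dest: topological_tendstoD)
qed

text \<open>
  A metric whose matrix is locally a Hessian is characterised by the total symmetry of the first
  derivatives \<open>T\<close> of its entries, so no potential has to be named.
\<close>

locale hessian_metric_2 =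
  fixes g :: "real ^ 2 \<Rightarrow> real ^ 2 ^ 2"
    and T :: "2 \<Rightarrow> 2 \<Rightarrow> 2 \<Rightarrow> real ^ 2 \<Rightarrow> real"
    and T' :: "2 \<Rightarrow> 2 \<Rightarrow> 2 \<Rightarrow> 2 \<Rightarrow> real ^ 2 \<Rightarrow> real"
    and U :: "(real ^ 2) set"
  assumes open_U: "open U"
    and det_nz: "\<And>y. y \<in> U \<Longrightarrow> det (g y) \<noteq> 0"
    and g_sym: "\<And>y i j. g y $ i $ j = g y $ j $ i"
    and DERIV_g: "\<And>y i j k. y \<in> U \<Longrightarrow>
       ((\<lambda>t. g (y + t *\<^sub>R axis k 1) $ i $ j) has_real_derivative T i j k y) (at 0)"
    and DERIV_T: "\<And>y i j k l. y \<in> U \<Longrightarrow>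
       ((\<lambda>t. T i j k (y + t *\<^sub>R axis l 1)) has_real_derivative T' i j k l y) (at 0)"
    and T_sym1: "\<And>i j k y. T i j k y = T j i k y"
    and T_sym2: "\<And>i j k y. T i j k y = T i k j y"
    and T'_sym: "\<And>i j k l y. T' i j k l y = T' i j l k y"
begin

lemma pderiv_at_g: "y \<in> U \<Longrightarrow> pderiv_at k (\<lambda>y. g y $ i $ j) y = T i j k y"
  unfolding pderiv_at_def by (rule DERIV_imp_deriv[OF DERIV_g])

lemma christoffel_eq:
  assumes "y \<in> U"
  shows "christoffel g l i j y = (\<Sum>m\<in>UNIV. matrix_inv (g y) $ l $ m * T m i j y) / 2"
proof -
  have "T m j i y + T m i j y - T i j m y = T m i j y" for m
    using T_sym1 T_sym2 by (metis add_diff_cancel_left')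
  thus ?thesis
    by (simp add: christoffel_def pderiv_at_g[OF assms])
qed

lemma christoffel_1:
  assumes "y \<in> U"
  shows "christoffel g 1 i j y = (g y $ 2 $ 2 * T 1 i j y - g y $ 1 $ 2 * T 2 i j y) / (2 * det (g y))"
  using det_nz[OF assms]
  by (simp add: christoffel_eq[OF assms] matrix_inv_2 sum_2 divide_simps)

lemma christoffel_2:
  assumes "y \<in> U"
  shows "christoffel g 2 i j y = (g y $ 1 $ 1 * T 2 i j y - g y $ 1 $ 2 * T 1 i j y) / (2 * det (g y))"
  using det_nz[OF assms] g_sym[of y 2 1]
  by (simp add: christoffel_eq[OF assms] matrix_inv_2 sum_2 divide_simps)

text \<open>
  Lowering the index removes the inverse matrix. This identity is differentiated below, so that
  the derivative of the inverse matrix never has to be computed.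
\<close>

lemma lower_christoffel:
  assumes "y \<in> U"
  shows "g y $ m $ 1 * christoffel g 1 i j y + g y $ m $ 2 * christoffel g 2 i j y = T m i j y / 2"
proof -
  define a b c where "a = g y $ 1 $ 1" and "b = g y $ 1 $ 2" and "c = g y $ 2 $ 2"
  have *: "g y $ 2 $ 1 = b" unfolding b_def by (rule g_sym)
  have d: "det (g y) = a * c - b * b" by (simp add: det_2 * a_def b_def c_def)
  have nz: "a * c - b * b \<noteq> 0" using det_nz[OF assms] d by simp
  have "m = 1 \<or> m = 2" by (rule exhaust_2)
  thus ?thesis
    using nz by (elim disjE) (simp_all add: christoffel_1[OF assms] christoffel_2[OF assms] d *
       divide_simps flip: a_def b_def c_def; simp add: algebra_simps)+
qed

text \<open>
  Only the existence of the derivative matters here: \<open>pderiv_at\<close> is an unspecified value where the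
  function is not differentiable.
\<close>

lemma DERIV_christoffel:
  assumes x: "x \<in> U"
  shows "((\<lambda>t. christoffel g l i j (x + t *\<^sub>R axis k 1)) has_real_derivative
           pderiv_at k (christoffel g l i j) x) (at 0)"
proof -
  let ?y = "\<lambda>t. x + t *\<^sub>R axis k 1"
  let ?f = "\<lambda>a y. (g y $ a $ a * T l i j y - g y $ 1 $ 2 * T a i j y) / (2 * det (g y))"
  have ndet: "g x $ 1 $ 1 * g x $ 2 $ 2 - g x $ 1 $ 2 * g x $ 2 $ 1 \<noteq> 0"
    using det_nz[OF x] by (simp add: det_2)
  have "\<exists>a. \<forall>y\<in>U. christoffel g l i j y = ?f a y"
    using exhaust_2[of l] christoffel_1 christoffel_2 by metis
  then obtain a where a: "christoffel g l i j y = ?f a y" if "y \<in> U" for y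
    by blast
  have ev: "eventually (\<lambda>t. christoffel g l i j (?y t) = ?f a (?y t)) (nhds 0)"
    using eventually_shift_in_open[OF open_U x, of k] by eventually_elim (rule a)
  note D = DERIV_g[OF x, of k] DERIV_T[OF x, of _ _ _ k]
  have "\<exists>D. ((\<lambda>t. ?f a (?y t)) has_real_derivative D) (at 0)"
    unfolding det_2 by (rule exI) (rule derivative_eq_intros D refl | use ndet in simp)+
  hence "\<exists>D. ((\<lambda>t. christoffel g l i j (?y t)) has_real_derivative D) (at 0)"
    by (subst DERIV_cong_ev[OF refl ev refl])
  thus ?thesis unfolding pderiv_at_def using DERIV_imp_deriv by blast
qed

lemma T'_swap:
  assumes "y \<in> U" shows "T' i j k l y = T' i k j l y"
  using DERIV_T[OF assms, of i j k l] DERIV_T[OF assms, of i k j l]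
  unfolding T_sym2[of i j k] by (rule DERIV_unique)

lemma lower_pderiv_christoffel:
  assumes x: "x \<in> U"
  shows "g x $ m $ 1 * pderiv_at k (christoffel g 1 i j) x
      + g x $ m $ 2 * pderiv_at k (christoffel g 2 i j) x
    = T' m i j k x / 2 - (T m 1 k x * christoffel g 1 i j x + T m 2 k x * christoffel g 2 i j x)"
proof -
  let ?y = "\<lambda>t. x + t *\<^sub>R axis k 1"
  let ?C = "\<lambda>l t. christoffel g l i j (?y t)"
  have "((\<lambda>t. T m i j (?y t) / 2) has_real_derivative T' m i j k x / 2) (at 0)"
    by (rule DERIV_cdivide[OF DERIV_T[OF x]])
  moreover have "((\<lambda>t. g (?y t) $ m $ 1 * ?C 1 t + g (?y t) $ m $ 2 * ?C 2 t) has_real_derivative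
     (T m 1 k x * ?C 1 0 + pderiv_at k (christoffel g 1 i j) x * g (?y 0) $ m $ 1) +
     (T m 2 k x * ?C 2 0 + pderiv_at k (christoffel g 2 i j) x * g (?y 0) $ m $ 2)) (at 0)"
    by (intro DERIV_add DERIV_mult DERIV_g DERIV_christoffel x)
  moreover have ev: "eventually (\<lambda>t. T m i j (?y t) / 2 =
      g (?y t) $ m $ 1 * ?C 1 t + g (?y t) $ m $ 2 * ?C 2 t) (nhds 0)"
    using eventually_shift_in_open[OF open_U x, of k] by eventually_elim (simp add: lower_christoffel)
  ultimately have "T' m i j k x / 2 =
     (T m 1 k x * ?C 1 0 + pderiv_at k (christoffel g 1 i j) x * g (?y 0) $ m $ 1) +
     (T m 2 k x * ?C 2 0 + pderiv_at k (christoffel g 2 i j) x * g (?y 0) $ m $ 2)"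
    by (subst (asm) DERIV_cong_ev[OF refl ev refl]) (rule DERIV_unique)
  thus ?thesis by (simp add: field_simps)
qed

text \<open>
  With lowered index, the fourth derivatives \<open>T'\<close> occur in the curvature as
  \<open>T' 1 2 2 1 - T' 1 1 2 2\<close>, which vanishes by symmetry. The remaining terms are products of
  Christoffel symbols with \<open>T\<close>, and raising the index by Cramer's rule gives the determinant of
  the matrix with rows \<open>(g\<^sub>1\<^sub>1, g\<^sub>1\<^sub>2, g\<^sub>2\<^sub>2)\<close>, \<open>(T\<^sub>1\<^sub>1\<^sub>1, T\<^sub>1\<^sub>1\<^sub>2, T\<^sub>1\<^sub>2\<^sub>2)\<close>, \<open>(T\<^sub>1\<^sub>1\<^sub>2, T\<^sub>1\<^sub>2\<^sub>2, T\<^sub>2\<^sub>2\<^sub>2)\<close>.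
\<close>

lemma sectional_curvature_hessian:
  assumes x: "x \<in> U"
  shows "sectional_curvature g x (axis 1 1) (axis 2 1) =
    - (g x $ 1 $ 1 * (T 1 1 2 x * T 2 2 2 x - (T 1 2 2 x)\<^sup>2)
       - g x $ 1 $ 2 * (T 1 1 1 x * T 2 2 2 x - T 1 1 2 x * T 1 2 2 x)
       + g x $ 2 $ 2 * (T 1 1 1 x * T 1 2 2 x - (T 1 1 2 x)\<^sup>2)) / (4 * (det (g x))\<^sup>2)"
proof -
  define C where "C = (\<lambda>l i j. christoffel g l i j x)"
  have axis: "axis (i::2) (1::real) $ j = (if j = i then 1 else 0)" for i j
    by (simp add: axis_def)
  have inner: "metric_inner g x u v = (\<Sum>i\<in>UNIV. \<Sum>j\<in>UNIV. u $ i * g x $ i $ j * v $ j)" for u v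
    by (simp add: metric_inner_def inner_vec_def matrix_vector_mult_def sum_distrib_left mult_ac)
  have op: "curvature_op g x (axis 1 1) (axis 2 1) (axis 2 1) $ l = riemann g l 1 2 2 x" for l
    by (simp add: curvature_op_def sum_2 axis)
  have T_perm: "T 2 1 1 x = T 1 1 2 x" "T 1 2 1 x = T 1 1 2 x" "T 2 1 2 x = T 1 2 2 x"
    "T 2 2 1 x = T 1 2 2 x"
    by (metis T_sym1 T_sym2)+
  have low: "g x $ 1 $ 1 * C 1 i j + g x $ 1 $ 2 * C 2 i j = T 1 i j x / 2" for i j
    unfolding C_def by (rule lower_christoffel[OF x])
  have "metric_inner g x (curvature_op g x (axis 1 1) (axis 2 1) (axis 2 1)) (axis 1 1) =
     g x $ 1 $ 1 * riemann g 1 1 2 2 x + g x $ 1 $ 2 * riemann g 2 1 2 2 x"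
    using g_sym[of x 2 1] by (simp add: inner op sum_2 axis)
  also have "\<dots> = (g x $ 1 $ 1 * pderiv_at 1 (christoffel g 1 2 2) x
       + g x $ 1 $ 2 * pderiv_at 1 (christoffel g 2 2 2) x)
     - (g x $ 1 $ 1 * pderiv_at 2 (christoffel g 1 1 2) x + g x $ 1 $ 2 * pderiv_at 2 (christoffel g 2 1 2) x)
     + (g x $ 1 $ 1 * C 1 1 1 + g x $ 1 $ 2 * C 2 1 1) * C 1 2 2
     + (g x $ 1 $ 1 * C 1 1 2 + g x $ 1 $ 2 * C 2 1 2) * C 2 2 2
     - (g x $ 1 $ 1 * C 1 2 1 + g x $ 1 $ 2 * C 2 2 1) * C 1 1 2
     - (g x $ 1 $ 1 * C 1 2 2 + g x $ 1 $ 2 * C 2 2 2) * C 2 1 2"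
    unfolding riemann_def sum_2 C_def[symmetric] by (simp add: C_def algebra_simps)
  also have "\<dots> = - (T 1 1 1 x * C 1 2 2 + T 1 1 2 x * C 2 2 2 - T 1 1 2 x * C 1 1 2 - T 1 2 2 x * C 2 1 2) / 2"
    unfolding low lower_pderiv_christoffel[OF x] T_perm C_def[symmetric]
    using T'_sym[of 1 2 2 1 x] T'_swap[OF x, of 1 2 1 2]
    by (simp add: T_perm C_def algebra_simps)
  finally have num: "metric_inner g x (curvature_op g x (axis 1 1) (axis 2 1) (axis 2 1)) (axis 1 1) =
     - (T 1 1 1 x * C 1 2 2 + T 1 1 2 x * C 2 2 2 - T 1 1 2 x * C 1 1 2 - T 1 2 2 x * C 2 1 2) / 2" .
  have den: "metric_inner g x (axis 1 1) (axis 1 1) * metric_inner g x (axis 2 1) (axis 2 1)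
       - (metric_inner g x (axis 1 1) (axis 2 1))\<^sup>2 = det (g x)"
    using g_sym[of x 2 1] by (simp add: inner sum_2 axis det_2 power2_eq_square)
  have "sectional_curvature g x (axis 1 1) (axis 2 1) =
     - (T 1 1 1 x * C 1 2 2 + T 1 1 2 x * C 2 2 2 - T 1 1 2 x * C 1 1 2 - T 1 2 2 x * C 2 1 2) / 2 / det (g x)"
    unfolding sectional_curvature_def num den ..
  also have "\<dots> = - (g x $ 1 $ 1 * (T 1 1 2 x * T 2 2 2 x - (T 1 2 2 x)\<^sup>2)
       - g x $ 1 $ 2 * (T 1 1 1 x * T 2 2 2 x - T 1 1 2 x * T 1 2 2 x)
       + g x $ 2 $ 2 * (T 1 1 1 x * T 1 2 2 x - (T 1 1 2 x)\<^sup>2)) / (4 * (det (g x))\<^sup>2)"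
    using det_nz[OF x] unfolding C_def christoffel_1[OF x] christoffel_2[OF x] T_perm
    by (simp add: divide_simps) (simp add: algebra_simps power2_eq_square)
  finally show ?thesis .
qed

end

section \<open>The metric of the beta distributions\<close>

text \<open>
  The third and fourth derivatives of the potential \<open>ln \<Gamma>(p\<^sub>1) + ln \<Gamma>(p\<^sub>2) - ln \<Gamma>(p\<^sub>1 + p\<^sub>2)\<close>.
\<close>

definition beta_d3 :: "2 \<Rightarrow> 2 \<Rightarrow> 2 \<Rightarrow> real ^ 2 \<Rightarrow> real" where
  "beta_d3 i j k p = (if i = j \<and> j = k then - 2 * hzeta 3 (p $ i) else 0) + 2 * hzeta 3 (p $ 1 + p $ 2)"

definition beta_d4 :: "2 \<Rightarrow> 2 \<Rightarrow> 2 \<Rightarrow> 2 \<Rightarrow> real ^ 2 \<Rightarrow> real" where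
  "beta_d4 i j k l p =
     (if i = j \<and> j = k \<and> k = l then 6 * hzeta 4 (p $ i) else 0) - 6 * hzeta 4 (p $ 1 + p $ 2)"

definition quadrant :: "(real ^ 2) set" where
  "quadrant = {p. 0 < p $ 1 \<and> 0 < p $ 2}"

lemma deriv_Digamma_eq_hzeta: "x > 0 \<Longrightarrow> deriv Digamma x = hzeta 2 x"
  using deriv_Digamma_eq_Polygamma[of x] hzeta_eq_Polygamma[of 0 x] by (simp add: numeral_2_eq_2)

lemma fisher_rao_beta_nth:
  assumes "p \<in> quadrant"
  shows "fisher_rao_beta p $ i $ j = (if i = j then hzeta 2 (p $ i) else 0) - hzeta 2 (p $ 1 + p $ 2)"
  using assms exhaust_2[of i] exhaust_2[of j]
  by (auto simp: fisher_rao_beta_def quadrant_def deriv_Digamma_eq_hzeta)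

lemma det_fisher_rao_beta:
  assumes "p \<in> quadrant"
  shows "det (fisher_rao_beta p) = hzeta 2 (p $ 1) * hzeta 2 (p $ 2) * hzeta 2 (p $ 1 + p $ 2) *
           (1 / hzeta 2 (p $ 1 + p $ 2) - 1 / hzeta 2 (p $ 1) - 1 / hzeta 2 (p $ 2))"
proof -
  have "hzeta 2 (p $ 1) > 0" "hzeta 2 (p $ 2) > 0" "hzeta 2 (p $ 1 + p $ 2) > 0"
    using assms by (auto intro!: hzeta_pos simp: quadrant_def)
  thus ?thesis
    by (simp add: det_2 fisher_rao_beta_nth[OF assms] field_simps)
qed

lemma det_fisher_rao_beta_pos:
  assumes "p \<in> quadrant"
  shows "det (fisher_rao_beta p) > 0"
proof -
  have p: "p $ 1 > 0" "p $ 2 > 0" using assms by (auto simp: quadrant_def)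
  have "0 < p $ 1 / (1 + p $ 1) * (p $ 2 / (1 + p $ 2)) / 4" using p by simp
  also have "\<dots> \<le> 1 / hzeta 2 (p $ 1 + p $ 2) - 1 / hzeta 2 (p $ 1) - 1 / hzeta 2 (p $ 2)"
    by (rule inverse_hzeta_2_defect[OF p])
  finally show ?thesis
    unfolding det_fisher_rao_beta[OF assms] using p by (intro mult_pos_pos hzeta_pos) auto
qed

lemma open_quadrant: "open quadrant"
  unfolding quadrant_def
  by (intro open_Collect_conj open_Collect_less continuous_intros)

lemma DERIV_hzeta_shift:
  fixes p :: "real ^ 2"
  assumes "p \<in> quadrant" "k \<ge> 2"
  shows "((\<lambda>t. hzeta k ((p + t *\<^sub>R axis l 1) $ i)) has_real_derivative
           (if i = l then - real k * hzeta (Suc k) (p $ i) else 0)) (at 0)" (is ?A)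
    and "((\<lambda>t. hzeta k ((p + t *\<^sub>R axis l 1) $ 1 + (p + t *\<^sub>R axis l 1) $ 2)) has_real_derivative
           - real k * hzeta (Suc k) (p $ 1 + p $ 2)) (at 0)" (is ?B)
proof -
  have p: "p $ i > 0" "p $ 1 + p $ 2 > 0" for i
    using assms(1) exhaust_2[of i] by (auto simp: quadrant_def)
  have 1: "((\<lambda>t. (p + t *\<^sub>R axis l 1) $ i) has_real_derivative (if i = l then 1 else 0)) (at 0)" for i
    by (auto simp: axis_def intro!: derivative_eq_intros)
  have "(hzeta k has_real_derivative - real k * hzeta (Suc k) (p $ i)) (at ((p + 0 *\<^sub>R axis l 1) $ i))"
    using DERIV_hzeta[OF p(1) assms(2)] by simp
  from DERIV_chain2[OF this 1] show ?A by (simp split: if_splits)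
  have 2: "((\<lambda>t. (p + t *\<^sub>R axis l 1) $ 1 + (p + t *\<^sub>R axis l 1) $ 2) has_real_derivative 1) (at 0)"
    using DERIV_add[OF 1[of 1] 1[of 2]] exhaust_2[of l] by auto
  have "(hzeta k has_real_derivative - real k * hzeta (Suc k) (p $ 1 + p $ 2))
      (at ((p + 0 *\<^sub>R axis l 1) $ 1 + (p + 0 *\<^sub>R axis l 1) $ 2))"
    using DERIV_hzeta[OF p(2) assms(2)] by simp
  from DERIV_chain2[OF this 2] show ?B by simp
qed

lemma hessian_metric_beta: "hessian_metric_2 fisher_rao_beta beta_d3 beta_d4 quadrant"
proof
  show "open quadrant" by (rule open_quadrant)
next
  fix y :: "real ^ 2" assume y: "y \<in> quadrant"
  show "det (fisher_rao_beta y) \<noteq> 0" using det_fisher_rao_beta_pos[OF y] by simp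
next
  fix y i j
  show "fisher_rao_beta y $ i $ j = fisher_rao_beta y $ j $ i"
    using exhaust_2[of i] exhaust_2[of j] by (auto simp: fisher_rao_beta_def)
next
  fix y :: "real ^ 2" and i j k :: 2 assume y: "y \<in> quadrant"
  let ?y = "\<lambda>t. y + t *\<^sub>R axis k 1"
  have "eventually (\<lambda>t. ?y t \<in> quadrant) (nhds 0)"
    by (rule eventually_shift_in_open[OF open_quadrant y])
  hence ev: "eventually (\<lambda>t. fisher_rao_beta (?y t) $ i $ j =
      (if i = j then hzeta 2 (?y t $ i) else 0) - hzeta 2 (?y t $ 1 + ?y t $ 2)) (nhds 0)"
    by eventually_elim (rule fisher_rao_beta_nth)
  have "((\<lambda>t. (if i = j then hzeta 2 (?y t $ i) else 0) - hzeta 2 (?y t $ 1 + ?y t $ 2))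
      has_real_derivative beta_d3 i j k y) (at 0)"
    using DERIV_hzeta_shift[OF y, of 2 k] y
    by (cases "i = j"; cases "j = k")
       (auto simp del: vector_add_component simp: beta_d3_def intro!: derivative_eq_intros)
  thus "((\<lambda>t. fisher_rao_beta (?y t) $ i $ j) has_real_derivative beta_d3 i j k y) (at 0)"
    by (subst DERIV_cong_ev[OF refl ev refl])
next
  fix y :: "real ^ 2" and i j k l :: 2 assume y: "y \<in> quadrant"
  show "((\<lambda>t. beta_d3 i j k (y + t *\<^sub>R axis l 1)) has_real_derivative beta_d4 i j k l y) (at 0)"
    using DERIV_hzeta_shift[OF y, of 3 l] y
    unfolding beta_d3_def beta_d4_def
    by (cases "i = j"; cases "j = k"; cases "k = l")
       (auto simp del: vector_add_component intro!: derivative_eq_intros)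
qed (auto simp: beta_d3_def beta_d4_def)

text \<open>
  With \<open>a\<^sub>k\<close>, \<open>b\<^sub>k\<close>, \<open>s\<^sub>k\<close> for the power sums at \<open>a\<close>, \<open>b\<close>, \<open>s = a + b\<close>, and with \<open>p = 1 / hzeta 2\<close>,
  the cubic determinant is \<open>8 a\<^sub>3 b\<^sub>3 s\<^sub>3 (h(s) - h(a) - h(b))\<close>, and the determinant of the metric is
  \<open>a\<^sub>2 b\<^sub>2 s\<^sub>2 (p(s) - p(a) - p(b))\<close>. Each factor \<open>2 hzeta 3 x / (hzeta 2 x)\<^sup>2\<close> is the derivative of
  \<open>p\<close> at \<open>x\<close>.
\<close>

lemma K_beta_eq:
  assumes "a > 0" "b > 0"
  defines "h \<equiv> \<lambda>x. hzeta 2 x / (2 * hzeta 3 x)"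
  shows "K_beta a b = - (1 / 4) *
     ((2 * hzeta 3 a / hzeta 2 a ^ 2) * (2 * hzeta 3 b / hzeta 2 b ^ 2)
      * (2 * hzeta 3 (a + b) / hzeta 2 (a + b) ^ 2)) *
     (h (a + b) - h a - h b) / (1 / hzeta 2 (a + b) - 1 / hzeta 2 a - 1 / hzeta 2 b) ^ 2"
proof -
  define p :: "real ^ 2" where "p = vector [a, b]"
  have p: "p \<in> quadrant" "p $ 1 = a" "p $ 2 = b" using assms by (auto simp: p_def quadrant_def)
  define a2 b2 s2 a3 b3 s3 where "a2 = hzeta 2 a" and "b2 = hzeta 2 b" and "s2 = hzeta 2 (a + b)"
    and "a3 = hzeta 3 a" and "b3 = hzeta 3 b" and "s3 = hzeta 3 (a + b)"
  note folds = a2_def [symmetric] b2_def [symmetric] s2_def [symmetric]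
    a3_def [symmetric] b3_def [symmetric] s3_def [symmetric]
  have pos: "a2 > 0" "b2 > 0" "s2 > 0" "a3 > 0" "b3 > 0" "s3 > 0"
    unfolding a2_def b2_def s2_def a3_def b3_def s3_def using assms by (auto intro!: hzeta_pos)
  define N where "N = s2 * a3 * b3 - a2 * b3 * s3 - b2 * a3 * s3"
  have "K_beta a b = - (4 * N) / (4 * (det (fisher_rao_beta p))\<^sup>2)"
    unfolding K_beta_def p_def[symmetric]
      hessian_metric_2.sectional_curvature_hessian[OF hessian_metric_beta p(1)]
    unfolding fisher_rao_beta_nth[OF p(1)] beta_d3_def p folds N_def
    by (simp add: algebra_simps power2_eq_square)
  also have "\<dots> = - N / (a2 * b2 * s2 * (1 / s2 - 1 / a2 - 1 / b2))\<^sup>2"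
    unfolding det_fisher_rao_beta[OF p(1)] p folds by simp
  also have "N = 2 * a3 * b3 * s3 * (h (a + b) - h a - h b)"
    unfolding h_def N_def folds using pos by (simp add: field_simps)
  also have "- (2 * a3 * b3 * s3 * (h (a + b) - h a - h b)) / (a2 * b2 * s2 * (1 / s2 - 1 / a2 - 1 / b2))\<^sup>2
     = - (1 / 4) * ((2 * a3 / a2 ^ 2) * (2 * b3 / b2 ^ 2) * (2 * s3 / s2 ^ 2)) *
         (h (a + b) - h a - h b) / (1 / s2 - 1 / a2 - 1 / b2) ^ 2"
    by (simp add: power_mult_distrib)
  finally show ?thesis unfolding folds .
qed

lemma deriv_inverse_hzeta_2_le:
  assumes "x > 0" shows "2 * hzeta 3 x / hzeta 2 x ^ 2 \<le> 8 * (x / (1 + x))"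
proof -
  have "((1 + x) / (2 * x ^ 2)) ^ 2 \<le> hzeta 2 x ^ 2"
    using hzeta_2_bounds[OF assms] assms by (intro power_mono) auto
  hence "2 * hzeta 3 x / hzeta 2 x ^ 2 \<le> 2 * ((1 + x) / x ^ 3) / ((1 + x) / (2 * x ^ 2)) ^ 2"
    using hzeta_3_bounds[OF assms] assms by (intro frac_le mult_left_mono) auto
  also have "\<dots> = 8 * (x / (1 + x))"
    using assms by (simp add: divide_simps) (simp add: algebra_simps eval_nat_numeral)
  finally show ?thesis .
qed

theorem proposition5:
  shows "(\<forall>\<alpha>>0. \<forall>\<beta>>0. K_beta \<alpha> \<beta> < 0) \<and>
         bdd_below {K_beta \<alpha> \<beta> | \<alpha> \<beta>. \<alpha> > 0 \<and> \<beta> > 0}"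
proof -
  have main: "K_beta a b < 0 \<and> - 32768 \<le> K_beta a b" if ab: "a > 0" "b > 0" for a b
  proof -
    define m where "m = (\<lambda>x::real. x / (1 + x))"
    define h where "h = (\<lambda>x. hzeta 2 x / (2 * hzeta 3 x))"
    define P where "P = (\<lambda>x. 2 * hzeta 3 x / hzeta 2 x ^ 2)"
    define dp where "dp = 1 / hzeta 2 (a + b) - 1 / hzeta 2 a - 1 / hzeta 2 b"
    define dh where "dh = h (a + b) - h a - h b"
    have K: "K_beta a b = - (1 / 4 * (P a * P b * P (a + b)) * dh / dp ^ 2)"
      using K_beta_eq[OF ab] by (simp add: P_def h_def dp_def dh_def)
    have m: "0 < m x" "m x \<le> 1" if "x > 0" for x using that by (auto simp: m_def)
    have P: "0 < P x" "P x \<le> 8 * m x" if "x > 0" for x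
      using that hzeta_pos[OF that, of 2] hzeta_pos[OF that, of 3] deriv_inverse_hzeta_2_le[OF that]
      by (auto simp: P_def m_def)
    have dp: "m a * m b / 4 \<le> dp"
      using inverse_hzeta_2_defect[OF ab] by (simp add: m_def dp_def)
    have dh: "0 < dh" "dh \<le> 16 * (m a * m b)"
      using hzeta_ratio_defect[OF ab] by (simp_all add: m_def dh_def h_def)
    have mm: "0 < m a * m b" using ab m by simp
    have "dp > 0" using dp mm by linarith
    hence neg: "K_beta a b < 0" unfolding K using dh P ab by simp
    have "1 / 4 * (P a * P b * P (a + b)) * dh / dp ^ 2
        \<le> 1 / 4 * ((8 * m a) * (8 * m b) * (8 * 1)) * (16 * (m a * m b)) / (m a * m b / 4) ^ 2"
    proof (intro frac_le mult_mono power_mono)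
      show "P (a + b) \<le> 8 * 1" using P(2)[of "a + b"] m(2)[of "a + b"] ab by simp
    qed (use P m ab dh dp mm in \<open>auto intro!: mult_nonneg_nonneg simp: less_imp_le\<close>)
    \<comment> \<open>All powers of \<open>m a\<close> and \<open>m b\<close> cancel.\<close>
    also have "\<dots> = 32768" using m[OF ab(1)] m[OF ab(2)] by (simp add: field_simps power2_eq_square)
    finally show ?thesis using neg unfolding K by simp
  qed
  thus ?thesis by (auto simp: bdd_below_def intro!: exI[of _ "- 32768"])
qed

end
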